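(* Let $\mathbf{A}\in\mathbb{C}^{n\times n}$ be nearly $\mathbf{M}$; that is, $\mathbf{M}\in\mathbb{C}^{n\times n}$ is invertible and there are matrices $\mathbf{U},\mathbf{V}\in\mathbb{C}^{n\times r}$ (for some $r\ge 1$) such that, with $\mathbf{N}=\mathbf{U}\mathbf{V}^T$, one has $\mathbf{A}=\mathbf{M}-\mathbf{N}$ and $\rho(\mathbf{V}^T\mathbf{M}^{-1}\mathbf{U})<1$. Then the Sherman-Morrison-Woodbury (SMW) iteration $$\mathbf{x}^{(k+1)}=\mathbf{M}^{-1}\left(\mathbf{N}\mathbf{x}^{(k)}+\mathbf{b}\right),\qquad k=0,1,2,\dots,$$ converges; that is, for every right-hand side $\mathbf{b}\in\mathbb{C}^n$ and every initial guess $\mathbf{x}^{(0)}\in\mathbb{C}^n$, the sequence $(\mathbf{x}^{(k)})_{k\ge 0}$ converges to the solution $\mathbf{x}$ of the linear system $\mathbf{A}\mathbf{x}=\mathbf{b}$.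
   Context: Here $\rho(\cdot)$ denotes the spectral radius (the maximum modulus of the complex eigenvalues) of a square complex matrix, and $\mathbf{V}^T$ is the (non-conjugate) transpose of $\mathbf{V}$. Definition: a matrix $\mathbf{A}\in\mathbb{C}^{n\times n}$ is called near $\mathbf{M}$ (or a nearly $\mathbf{M}$ matrix) if $\mathbf{M}$ is an invertible matrix and there is a matrix $\mathbf{N}=\mathbf{U}\mathbf{V}^T$, for appropriate $\mathbf{U},\mathbf{V}$, such that $\mathbf{A}=\mathbf{M}-\mathbf{N}$ and $\rho(\mathbf{V}^T\mathbf{M}^{-1}\mathbf{U})<1$. Under this condition $\det(\mathbf{I}-\mathbf{V}^T\mathbf{M}^{-1}\mathbf{U})\neq 0$ and $\mathbf{A}$ is invertible, so $\mathbf{A}\mathbf{x}=\mathbf{b}$ has a unique solution. No symmetry or diagonal dominance of $\mathbf{A}$ is assumed. *)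

theory Defs
  imports "HOL-Analysis.Analysis"
begin

definition eigenvalues :: "complex^'n^'n \<Rightarrow> complex set" where
  "eigenvalues B = {c. \<exists>v. v \<noteq> 0 \<and> B *v v = c *s v}"

text \<open>The set of eigenvalues is finite and nonempty (index types are never empty),
  so \<^const>\<open>Max\<close> denotes an actual maximum.\<close>

definition spec_radius :: "complex^'n^'n \<Rightarrow> real" where
  "spec_radius B = Max (cmod ` eigenvalues B)"

text \<open>\<open>A\<close> is near \<open>M\<close>, witnessed by the splitting \<open>A = M - N\<close> with \<open>N = U V\<^sup>T\<close>.
  In \<^typ>\<open>complex^'r^'n\<close> the outer index counts rows, so \<open>U\<close> and \<open>V\<close> are \<open>n\<close>-by-\<open>r\<close>
  matrices. The witnesses are parameters because \<open>r\<close>, being the size of a type, cannot be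
  bound by an existential quantifier; a theorem assuming \<open>nearly\<close> for free \<open>U\<close>, \<open>V\<close> and
  \<open>'r\<close> holds for every choice of them. The transpose is not conjugated.\<close>

definition nearly ::
  "complex^'n^'n \<Rightarrow> complex^'n^'n \<Rightarrow> complex^'n^'n \<Rightarrow> complex^'r^'n \<Rightarrow> complex^'r^'n \<Rightarrow> bool" where
  "nearly A M N U V \<longleftrightarrow>
     invertible M \<and> N = U ** transpose V \<and> A = M - N \<and>
     spec_radius (transpose V ** matrix_inv M ** U) < 1"

end

theory Submission
  imports Defs "HOL-Computational_Algebra.Fundamental_Theorem_Algebra"
begin

text \<open>
  Write \<open>B = V\<^sup>T M\<^sup>-\<^sup>1 U\<close>. If \<open>s\<close> solves the system, the error \<open>e\<^sub>k = x\<^sub>k - s\<close> satisfies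
  \<open>e\<^sub>k\<^sub>+\<^sub>1 = M\<^sup>-\<^sup>1 U (V\<^sup>T e\<^sub>k)\<close>, so the vectors \<open>V\<^sup>T e\<^sub>k\<close> are the orbit of \<open>V\<^sup>T e\<^sub>0\<close> under the
  (typically small) matrix \<open>B\<close>, and \<open>e\<^sub>k \<rightarrow> 0\<close> follows once all orbits of \<open>B\<close> tend to \<open>0\<close>. The
  same fact makes \<open>A\<close> injective: \<open>A y = 0\<close> turns \<open>V\<^sup>T y\<close> into a fixed point of \<open>B\<close>, hence
  into \<open>0\<close>, and then \<open>y = M\<^sup>-\<^sup>1 U V\<^sup>T y = 0\<close>.

  That orbits of a matrix with spectral radius below \<open>1\<close> tend to \<open>0\<close> is proved without normal
  forms (\<open>orbit_tendsto_0\<close>). Some nonzero polynomial \<open>p\<close> annihilates \<open>B\<close>, because the powers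
  of \<open>B\<close> live in a finite-dimensional space (\<open>annihilating_poly_exists\<close>). Induction on the
  degree then removes one linear factor \<open>B - a\<close> at a time
  (\<open>orbit_tendsto_0_if_linear_factor\<close>): if the orbit of \<open>(B - a) v\<close> tends to \<open>0\<close>, so does that of \<open>v\<close>. When
  \<open>a\<close> is not an eigenvalue this is because \<open>B - a\<close> has an inverse, which commutes with
  \<open>B\<close>; when it is one, \<open>\<bar>a\<bar> < 1\<close> and the orbit of \<open>v\<close> is a contraction driven by a null
  sequence.
\<close>

section \<open>Polynomials acting on vectors through a matrix\<close>

text \<open>
  This is \<open>p(B) v\<close> in Horner form, which suits induction over \<^const>\<open>pCons\<close> and avoids matrix
  powers: multiplication on \<^typ>\<open>complex^'n^'n\<close> is componentwise, so the power operator does not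
  denote them.
\<close>

definition poly_act :: "complex^'n^'n \<Rightarrow> complex poly \<Rightarrow> complex^'n \<Rightarrow> complex^'n" where
  "poly_act B p v = fold_coeffs (\<lambda>a w. a *s v + B *v w) p 0"

lemma poly_act_0 [simp]: "poly_act B 0 v = 0"
  by (simp add: poly_act_def)

lemma poly_act_pCons [simp]: "poly_act B (pCons a p) v = a *s v + B *v poly_act B p v"
proof (cases "p = 0 \<and> a = 0")
  case True
  then show ?thesis by simp
next
  case False
  then show ?thesis by (auto simp: poly_act_def)
qed

lemma poly_act_add: "poly_act B (p + q) v = poly_act B p v + poly_act B q v"
  by (induction p q rule: poly_induct2)
    (simp_all add: vector_sadd_rdistrib matrix_vector_right_distrib)

lemma poly_act_sum: "poly_act B (\<Sum>i\<in>I. f i) v = (\<Sum>i\<in>I. poly_act B (f i) v)"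
  by (induction I rule: infinite_finite_induct) (simp_all add: poly_act_add)

lemma poly_act_smult: "poly_act B (smult c p) v = c *s poly_act B p v"
  by (induction p)
    (simp_all add: vec.scale_right_distrib vector_smult_assoc vector_scalar_commute)

lemma poly_act_monom: "poly_act B (monom c i) v = c *s ((*v) B ^^ i) v"
  by (induction i) (simp_all add: monom_0 monom_Suc vector_scalar_commute)

lemma poly_act_diff: "poly_act B p (v - w) = poly_act B p v - poly_act B p w"
  by (induction p)
    (simp_all add: vec.scale_right_diff_distrib matrix_vector_mult_diff_distrib)

lemma poly_act_scale: "poly_act B p (c *s v) = c *s poly_act B p v"
  by (induction p)
    (simp_all add: vec.scale_right_distrib vector_smult_assoc mult.commute vector_scalar_commute)

lemma poly_act_mult_vec: "poly_act B p (B *v v) = B *v poly_act B p v"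
  by (induction p)
    (simp_all add: matrix_vector_right_distrib vector_scalar_commute)

lemma poly_act_linear_factor: "poly_act B ([:-a, 1:] * q) v = poly_act B q (B *v v - a *s v)"
proof -
  have "[:-a, 1:] * q = smult (-a) q + pCons 0 q" by simp
  then show ?thesis
    by (simp only: poly_act_add poly_act_smult poly_act_diff poly_act_scale poly_act_mult_vec
        poly_act_pCons) simp
qed

lemma poly_act_eigenvector:
  assumes "B *v v = c *s v"
  shows "poly_act B p v = poly p c *s v"
  using assms
  by (induction p) (simp_all add: vector_scalar_commute vector_smult_assoc vector_sadd_rdistrib mult.commute)

section \<open>An annihilating polynomial and the spectrum\<close>

text \<open>
  The powers of \<open>B\<close> up to the real dimension of the matrix space are too many to be
  linearly independent. Real dependence suffices, and it gives an annihilating polynomial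
  with real coefficients; a repetition among the powers gives one directly.
\<close>

lemma annihilating_poly_exists:
  fixes B :: "complex^'n^'n"
  shows "\<exists>p. p \<noteq> 0 \<and> (\<forall>v. poly_act B p v = 0)"
proof -
  define P where "P = (\<lambda>i::nat. ((\<lambda>X. B ** X) ^^ i) (mat 1))"
  have P: "P i *v v = ((*v) B ^^ i) v" for i v
    by (induction i) (simp_all add: P_def flip: matrix_vector_mul_assoc)
  let ?N = "DIM(complex^'n^'n)"
  show ?thesis
  proof (cases "inj_on P {..?N}")
    case False
    then obtain i j where ij: "P i = P j" "i \<noteq> j"
      by (auto simp: inj_on_def)
    let ?p = "monom 1 i + monom (-1) j :: complex poly"
    have "coeff ?p i = 1" using ij by simp
    then have "?p \<noteq> 0" by force
    moreover have "poly_act B ?p v = 0" for v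
      using ij(1) P[of i v] P[of j v] by (simp add: poly_act_add poly_act_monom)
    ultimately show ?thesis by blast
  next
    case True
    have "dependent (P ` {..?N})"
      using independent_card_le[of "P ` {..?N}"] by (auto simp: card_image[OF True] simp del: DIM_cart)
    then obtain u k where u: "(\<Sum>X\<in>P ` {..?N}. u X *\<^sub>R X) = 0" "k \<le> ?N" "u (P k) \<noteq> 0"
      by (auto simp: dependent_finite)
    let ?p = "\<Sum>i\<le>?N. monom (of_real (u (P i))) i :: complex poly"
    have "coeff ?p k = of_real (u (P k))"
      using u(2) by (simp add: coeff_sum)
    then have "?p \<noteq> 0" using u(3) by force
    moreover have "poly_act B ?p v = 0" for v
    proof -
      have scale: "complex_of_real c *s w = c *\<^sub>R w" for c and w :: "complex^'n"
        by (simp add: vec_eq_iff flip: scaleR_conv_of_real)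
      have scale_matrix: "(c *\<^sub>R X) *v w = c *\<^sub>R (X *v w)"
        for c and X :: "complex^'n^'n" and w
        by (simp add: vec_eq_iff matrix_vector_mult_def scaleR_sum_right)
      have "poly_act B ?p v = (\<Sum>i\<le>?N. (u (P i) *\<^sub>R P i) *v v)"
        unfolding poly_act_sum poly_act_monom scale
        by (simp add: scale_matrix flip: P)
      also have "\<dots> = (\<Sum>i\<le>?N. u (P i) *\<^sub>R P i) *v v"
        by (induction rule: infinite_finite_induct[where A = "{..?N}"])
          (simp_all add: matrix_vector_mult_add_rdistrib)
      also have "(\<Sum>i\<le>?N. u (P i) *\<^sub>R P i) = 0"
        using u(1) by (simp only: sum.reindex[OF True] o_def)
      finally show ?thesis by simp
    qed
    ultimately show ?thesis by blast
  qed
qed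

text \<open>
  Eigenvalues are roots of any annihilating polynomial. Finiteness is what makes the
  \<^const>\<open>Max\<close> in \<^const>\<open>spec_radius\<close> an upper bound.
\<close>

lemma finite_eigenvalues: "finite (eigenvalues B)"
proof -
  obtain p where p: "p \<noteq> 0" "\<And>v. poly_act B p v = 0"
    using annihilating_poly_exists by blast
  have "poly p c = 0" if "c \<in> eigenvalues B" for c
    using that p(2) poly_act_eigenvector[of B _ c p] by (auto simp: eigenvalues_def)
  then have "eigenvalues B \<subseteq> {c. poly p c = 0}" by blast
  then show ?thesis using poly_roots_finite[OF p(1)] finite_subset by blast
qed

lemma eigenvalue_le_spec_radius: "c \<in> eigenvalues B \<Longrightarrow> cmod c \<le> spec_radius B"
  unfolding spec_radius_def by (simp add: finite_eigenvalues)

section \<open>Orbits of a matrix with spectral radius below one\<close>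

text \<open>
  The map \<open>t \<mapsto> \<bar>a\<bar> t + (1 - \<bar>a\<bar>) \<delta>\<close> has the fixed point \<open>\<delta>\<close> and contracts towards it by the
  factor \<open>\<bar>a\<bar>\<close>. With \<open>\<delta> = \<epsilon> / 2\<close> it dominates the norms \<open>\<bar>y\<^sub>k\<bar>\<close> from the index on at which
  the perturbations stay below \<open>(1 - \<bar>a\<bar>) \<delta>\<close>.
\<close>

lemma perturbed_contraction_tendsto_0:
  fixes y e :: "nat \<Rightarrow> complex"
  assumes step: "\<And>k. y (Suc k) = a * y k + e k" and e: "e \<longlonglongrightarrow> 0" and a: "cmod a < 1"
  shows "y \<longlonglongrightarrow> 0"
proof (rule LIMSEQ_I)
  fix \<epsilon> :: real assume "\<epsilon> > 0"
  let ?\<delta> = "\<epsilon> / 2"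
  have "(1 - cmod a) * ?\<delta> > 0" using \<open>\<epsilon> > 0\<close> a by simp
  from LIMSEQ_D[OF e this] obtain m where m: "\<And>k. k \<ge> m \<Longrightarrow> cmod (e k) < (1 - cmod a) * ?\<delta>"
    by auto
  have bound: "cmod (y (m + k)) \<le> cmod a ^ k * cmod (y m) + ?\<delta>" for k
  proof (induction k)
    case 0
    then show ?case using \<open>\<epsilon> > 0\<close> by simp
  next
    case (Suc k)
    have "cmod (y (m + Suc k)) \<le> cmod a * cmod (y (m + k)) + cmod (e (m + k))"
      using norm_triangle_ineq[of "a * y (m + k)" "e (m + k)"] by (simp add: step norm_mult)
    also have "\<dots> \<le> cmod a * (cmod a ^ k * cmod (y m) + ?\<delta>) + (1 - cmod a) * ?\<delta>"
      using Suc m[of "m + k"] by (intro add_mono mult_left_mono) auto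
    also have "\<dots> = cmod a ^ Suc k * cmod (y m) + ?\<delta>"
      by (simp add: field_simps)
    finally show ?case .
  qed
  have "(\<lambda>k. cmod a ^ k * cmod (y m)) \<longlonglongrightarrow> 0"
    using a by (intro tendsto_mult_left_zero LIMSEQ_power_zero) simp
  from LIMSEQ_D[OF this, of ?\<delta>] \<open>\<epsilon> > 0\<close>
  obtain l where l: "\<And>k. k \<ge> l \<Longrightarrow> cmod a ^ k * cmod (y m) < ?\<delta>" by auto
  have "cmod (y k) < \<epsilon>" if "k \<ge> m + l" for k
  proof -
    have "l \<le> k - m" "m + (k - m) = k" using that by simp_all
    then show ?thesis using bound[of "k - m"] l[of "k - m"] by simp
  qed
  then show "\<exists>k0. \<forall>k\<ge>k0. norm (y k - 0) < \<epsilon>" by auto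
qed

lemma tendsto_matrix_vector_mult:
  fixes A :: "complex^'n^'m"
  assumes "(f \<longlongrightarrow> l) F"
  shows "((\<lambda>k. A *v f k) \<longlongrightarrow> A *v l) F"
  unfolding matrix_vector_mult_def
  by (intro vec_tendstoI) (simp, intro tendsto_intros tendsto_vec_nth assms)

text \<open>
  The orbit of \<open>(B - a) v\<close> is the image of the orbit of \<open>v\<close> under \<open>B - a\<close>, since powers of
  \<open>B\<close> commute with \<open>B - a\<close>. If \<open>a\<close> is not an eigenvalue, a left inverse \<open>C\<close> of \<open>B - a\<close> carries
  the null sequence back. Otherwise \<open>\<bar>a\<bar> < 1\<close>, and each component of the orbit of \<open>v\<close> is a
  perturbed contraction.
\<close>

lemma orbit_tendsto_0_if_linear_factor:
  fixes B :: "complex^'n^'n"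
  assumes rho: "spec_radius B < 1"
    and lim: "(\<lambda>k. ((*v) B ^^ k) (B *v v - a *s v)) \<longlonglongrightarrow> 0"
  shows "(\<lambda>k. ((*v) B ^^ k) v) \<longlonglongrightarrow> 0"
proof -
  let ?T = "\<lambda>k. (*v) B ^^ k"
  have orbit: "?T k (B *v v - a *s v) = B *v ?T k v - a *s ?T k v" for k
    by (induction k) (simp_all add: matrix_vector_mult_diff_distrib vector_scalar_commute)
  show ?thesis
  proof (cases "a \<in> eigenvalues B")
    case True
    then have a: "cmod a < 1" using eigenvalue_le_spec_radius rho by fastforce
    show ?thesis
    proof (rule vec_tendstoI)
      fix i
      have e: "(\<lambda>k. ?T k (B *v v - a *s v) $ i) \<longlonglongrightarrow> 0"
        using tendsto_vec_nth[OF lim, of i] by simp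
      have "?T (Suc k) v $ i = a * ?T k v $ i + ?T k (B *v v - a *s v) $ i" for k
        unfolding orbit by simp
      then have "(\<lambda>k. ?T k v $ i) \<longlonglongrightarrow> 0"
        by (rule perturbed_contraction_tendsto_0) (fact e, fact a)
      then show "(\<lambda>k. ?T k v $ i) \<longlonglongrightarrow> 0 $ i" by simp
    qed
  next
    case False
    let ?D = "B - mat a"
    have mat_a: "mat a *v w = a *s w" for w :: "complex^'n"
      by (simp add: vec_eq_iff matrix_vector_mult_def mat_def if_distrib if_distribR cong: if_cong)
    have D: "?D *v w = B *v w - a *s w" for w
      by (simp add: matrix_vector_mult_diff_rdistrib mat_a)
    have "w = 0" if "?D *v w = 0" for w
      using that False by (auto simp: D eigenvalues_def)
    then obtain C where "C ** ?D = mat 1"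
      using matrix_left_invertible_ker by blast
    then have "C *v (?D *v w) = w" for w
      by (simp add: matrix_vector_mul_assoc)
    then have "C *v ?T k (B *v v - a *s v) = ?T k v" for k
      unfolding orbit by (simp only: flip: D)
    then show ?thesis
      using tendsto_matrix_vector_mult[OF lim, of C] by simp
  qed
qed

lemma orbit_tendsto_0_if_annihilated:
  fixes B :: "complex^'n^'n"
  assumes "spec_radius B < 1" "p \<noteq> 0" "poly_act B p v = 0"
  shows "(\<lambda>k. ((*v) B ^^ k) v) \<longlonglongrightarrow> 0"
  using assms(2,3)
proof (induction "degree p" arbitrary: p v)
  case 0
  then obtain c where "p = [:c:]" "c \<noteq> 0"
    by (metis degree_eq_zeroE pCons_0_0)
  with 0 have v: "v = 0" by simp
  have "((*v) B ^^ k) 0 = 0" for k by (induction k) simp_all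
  then show ?case by (simp add: v)
next
  case (Suc d)
  then have "\<not> constant (poly p)" by (simp add: constant_degree)
  then obtain a where "poly p a = 0" using fundamental_theorem_of_algebra by blast
  then obtain q where q: "p = [:-a, 1:] * q" by (metis dvdE poly_eq_0_iff_dvd)
  then have q0: "q \<noteq> 0" using Suc.prems by auto
  then have "degree p = Suc (degree q)" unfolding q by (subst degree_mult_eq) auto
  with Suc.hyps(2) have "d = degree q" by simp
  moreover have "poly_act B q (B *v v - a *s v) = 0"
    using Suc.prems(2) unfolding q poly_act_linear_factor .
  ultimately show ?case
    using orbit_tendsto_0_if_linear_factor[OF assms(1)] Suc.hyps(1) q0 by blast
qed

theorem orbit_tendsto_0:
  fixes B :: "complex^'n^'n"
  assumes "spec_radius B < 1"
  shows "(\<lambda>k. ((*v) B ^^ k) v) \<longlonglongrightarrow> 0"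
  using annihilating_poly_exists[of B] orbit_tendsto_0_if_annihilated[OF assms] by blast

section \<open>Convergence of the iteration\<close>

lemma matrix_inv_left: "invertible M \<Longrightarrow> matrix_inv M ** M = mat 1"
  unfolding invertible_def matrix_inv_def by (rule someI2_ex) auto

theorem theorem2p1:
  fixes A M N :: "complex^'n^'n" and U V :: "complex^'r^'n"
    and b :: "complex^'n" and x :: "nat \<Rightarrow> complex^'n"
  assumes "nearly A M N U V"
    and "\<And>k. x (Suc k) = matrix_inv M *v (N *v x k + b)"
  shows "\<exists>s. (\<forall>y. A *v y = b \<longleftrightarrow> y = s) \<and> x \<longlonglongrightarrow> s"
proof -
  (* Products with \<open>transpose V\<close> stay in the form in which they chain with matrices. *)
  note transpose_matrix_vector [simp del]
  define W where "W = matrix_inv M ** U"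
  define B where "B = transpose V ** W"
  have M: "invertible M" and N: "N = U ** transpose V" and A: "A = M - N"
    and rho: "spec_radius B < 1"
    using assms(1) by (simp_all add: nearly_def B_def W_def matrix_mul_assoc)
  have inv: "matrix_inv M *v (M *v y) = y" for y
    using matrix_inv_left[OF M] by (simp add: matrix_vector_mul_assoc)
  have N_W: "matrix_inv M *v (N *v y) = W *v (transpose V *v y)" for y
    by (simp add: N W_def matrix_vector_mul_assoc matrix_mul_assoc)
  have V_W: "transpose V *v (W *v z) = B *v z" for z
    by (simp add: B_def matrix_vector_mul_assoc)

  have "y = 0" if "A *v y = 0" for y
  proof -
    let ?z = "transpose V *v y"
    have "M *v y = N *v y"
      using that by (simp add: A matrix_vector_mult_diff_rdistrib)
    then have y: "y = W *v ?z" using inv[of y] N_W[of y] by simp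
    then have fixed: "B *v ?z = ?z" using V_W[of ?z] by simp
    have "((*v) B ^^ k) ?z = ?z" for k
      by (induction k) (simp_all add: fixed)
    then have "?z = 0"
      using orbit_tendsto_0[OF rho, of ?z] by (simp add: LIMSEQ_const_iff)
    with y show "y = 0" by simp
  qed
  then obtain C where "C ** A = mat 1"
    using matrix_left_invertible_ker by blast
  then have CA: "C *v (A *v y) = y" and AC: "A *v (C *v y) = y" for y
    using matrix_left_right_inverse[of C A] by (simp_all add: matrix_vector_mul_assoc)
  define s where "s = C *v b"
  have sol: "A *v y = b \<longleftrightarrow> y = s" for y
    using CA AC by (auto simp: s_def)

  have "M *v s = N *v s + b"
    using sol[of s] by (simp add: A matrix_vector_mult_diff_rdistrib algebra_simps)
  then have s: "s = matrix_inv M *v (N *v s + b)"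
    using inv[of s] by simp
  define e where "e = (\<lambda>k. x k - s)"
  have e_Suc: "e (Suc k) = W *v (transpose V *v e k)" for k
  proof -
    have "e (Suc k) = matrix_inv M *v (N *v x k + b) - matrix_inv M *v (N *v s + b)"
      using s by (simp add: e_def assms(2))
    also have "\<dots> = matrix_inv M *v (N *v e k)"
      by (simp add: e_def flip: matrix_vector_mult_diff_distrib)
    finally show ?thesis by (simp add: N_W)
  qed
  have "((*v) B ^^ k) (transpose V *v e 0) = transpose V *v e k" for k
    by (induction k) (simp_all add: e_Suc V_W)
  then have "(\<lambda>k. transpose V *v e k) \<longlonglongrightarrow> 0"
    using orbit_tendsto_0[OF rho, of "transpose V *v e 0"] by simp
  then have "(\<lambda>k. e (Suc k)) \<longlonglongrightarrow> 0"
    unfolding e_Suc using tendsto_matrix_vector_mult[of _ 0 sequentially W] by simp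
  then have "e \<longlonglongrightarrow> 0" by (simp only: filterlim_sequentially_Suc)
  then have "x \<longlonglongrightarrow> s" unfolding e_def by (simp only: LIM_zero_iff)
  with sol show ?thesis by blast
qed

end
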